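(* With all attention modules and all neural networks $\operatorname{ReLU}$-activated, the following hold. (i) An attention module is a cubic spline (a spline of degree $3$). (ii) A masked attention module is a cubic spline. (iii) An encoder--decoder attention module is a cubic spline (in the pair of variables $(X,Y)$). (iv) An encoder block is a cubic spline. (v) A decoder block is a cubic spline. (vi) An encoder--decoder block is a quintic spline (a spline of degree $5$ in $(X,Y)$). (vii) A $t$-layer encoder is a spline of degree $3^t$. (viii) A $t$-layer decoder is a spline of degree $3^t$. (ix) An encoder--decoder with an $s$-layer encoder and $t$ layers of encoder--decoder blocks is a spline of degree $3^{t+s}+3^t-3^s$ in $(X,Y)$.
   Context: **Splines.** Given polynomials $\pi_1,\dots,\pi_b\in\mathbb{R}[x_1,\dots,x_N]$ and a function $\theta:\{1,\dots,b\}\to\{1,0,-1\}$, let $\Pi_\theta=\{x\in\mathbb{R}^N:\operatorname{sgn}(\pi_i(x))=\theta(i),\ i=1,\dots,b\}$; the sets $\Pi_\theta$ form the semialgebraic partition of $\mathbb{R}^N$ induced by $\pi_1,\dots,\pi_b$. A continuous function $f:\mathbb{R}^N\to\mathbb{R}$ is a spline of degree $k$ (with respect to $\pi_1,\dots,\pi_b$) if every $\pi_i$ has degree not more than $k$ and, on each nonempty $\Pi_\theta$, $f$ agrees with some polynomial of degree not more than $k$. $S_k(\pi_1,\dots,\pi_b)$ denotes the set of these. "Degree $k$" always means "degree not more than $k$". A vector- or matrix-valued function is a spline of degree $k$ if all its coordinates lie in $S_k(\pi_1,\dots,\pi_b)$ for some common $\pi_1,\dots,\pi_b$. A function of a matrix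 in $\mathbb{R}^{n\times p}$ (or of a pair of matrices) is regarded as a function of all the entries, i.e. the polynomials are in the entries. **Neural networks.** $\operatorname{ReLU}(x)=\max(x,0)$, applied entrywise to vectors and matrices. An $l$-layer (feed forward, $\operatorname{ReLU}$-activated) neural network is a map $\varphi:\mathbb{R}^n\to\mathbb{R}^{n_{l+1}}$, $\varphi(x)=A_{l+1}\sigma_lA_l\cdots\sigma_2A_2\sigma_1A_1x+b_{l+1}$ (composition of maps) with $A_i\in\mathbb{R}^{n_i\times n_{i-1}}$, $n_0=n$, $\sigma_i(x)=\operatorname{ReLU}(x+b_i)$, $b_i\in\mathbb{R}^{n_i}$. Applied to a matrix in $\mathbb{R}^{n\times p}$, it acts on each of the $p$ columns separately. **Attention modules.** A single-head attention module is a map $\alpha:\mathbb{R}^{n\times p}\to\mathbb{R}^{m\times p}$, $\alpha(X)=V(X)\operatorname{ReLU}(K(X)^{\mathsf T}Q(X))$, where $Q(X)=A_QX+B_Q$, $K(X)=A_KX+B_K$, $V(X)=A_VX+B_V$ with $A_Q,A_K\in\mathbb{R}^{d\times n}$, $A_V\in\mathbb{R}^{m\times n}$, $B_Q,B_K\in\mathbb{R}^{d\times p}$, $B_V\in\mathbb{R}^{m\times p}$. A single-head masked attention module is $\beta(X)=V(X)\operatorname{ReLU}(\operatorname{mask}(K(X)^{\mathsf T}Q(X)))$, where $\operatorname{mask}:\mathbb{R}^{p\times p}\to(\mathbb{R}\cup\{-\infty\})^{p\times p}$ keeps entries $(i,j)$ with $i\le j$ and replaces entries with $i>j$ by $-\infty$,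 and $\operatorname{ReLU}(-\infty)=0$. A single-head encoder--decoder attention module is $\gamma:\mathbb{R}^{n\times p}\times\mathbb{R}^{r\times p}\to\mathbb{R}^{m\times p}$, $\gamma(X,Y)=V(X)\operatorname{ReLU}(K(X)^{\mathsf T}Q(Y))$, with $A_Q\in\mathbb{R}^{d\times r}$, $A_K\in\mathbb{R}^{d\times n}$, $A_V\in\mathbb{R}^{m\times n}$ and biases as before. An $h$-headed version of any of these is the map obtained by stacking the outputs of $h$ single-head modules (with the same input) vertically. The modules may be single-head or multihead. **Encoders, decoders, encoder--decoders.** All maps below have compatible dimensions. An encoder block is $\varepsilon=\varphi\circ\alpha$ with $\alpha$ a (multihead) attention module and $\varphi$ a neural network; a $t$-layer encoder is a composition of $t$ encoder blocks, $\varphi_t\circ\alpha_t\circ\cdots\circ\varphi_1\circ\alpha_1$. A decoder block is $\delta=\varphi\circ\beta$ with $\beta$ a (multihead) masked attention module; a $t$-layer decoder is a map $\varphi_t\circ\beta_t\circ\cdots\circ\varphi_1\circ\beta_1$ obtained from a $t$-layer encoder by replacing some or all of the attention modules by masked attention modules. An encoder--decoder block is $\tau(X,Y)=\varphi(\gamma(X,\beta(Y)))$ with $\beta$ a multihead masked attention module, $\gamma$ a multihead encoder--decoder attention module, $\varphi$ a neural network. An encoder--decoder with an $s$-layer encoder $\varepsilon_s$ and $t$ layers of encoder--decoder blocks (given by $\beta_i,\gamma_i,\varphi_i$, $i=1,\dots,t$) is the map $\tau_t$ defined recursively by $\tau_0(X,Y)=Y$ and $\tau_i(X,Y)=\varphi_i(\gamma_i(\varepsilon_s(X),\beta_i(\tau_{i-1}(X,Y))))$.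 *)

theory Defs
  imports
    "HOL-Library.Poly_Mapping"
    "HOL-Library.Extended_Real"
    "HOL-Analysis.Function_Topology"
    "Jordan_Normal_Form.Matrix"
begin

section \<open>Real polynomials in finitely many variables\<close>

text \<open>Variables are the elements of an index set \<open>V\<close>. The space of points is
  \<open>V \<rightarrow>\<^sub>E UNIV\<close>, the carrier of \<^term>\<open>powertop_real V\<close>; for \<open>V\<close> with \<open>N\<close> elements this is
  the usual space of real \<open>N\<close>-tuples. Working with an arbitrary \<open>V\<close> lets the entries of a matrix,
  or of a pair of matrices, serve as variables.\<close>

type_synonym 'v mpoly = "('v \<Rightarrow>\<^sub>0 nat) \<Rightarrow>\<^sub>0 real"

definition mpoly_eval :: "('v \<Rightarrow> real) \<Rightarrow> 'v mpoly \<Rightarrow> real" where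
  "mpoly_eval x f =
     (\<Sum>m\<in>Poly_Mapping.keys f. Poly_Mapping.lookup f m * (\<Prod>v\<in>Poly_Mapping.keys m. x v ^ Poly_Mapping.lookup m v))"

definition mpoly_vars :: "'v mpoly \<Rightarrow> 'v set" where
  "mpoly_vars f = (\<Union>m\<in>Poly_Mapping.keys f. Poly_Mapping.keys m)"

text \<open>The zero polynomial gets total degree \<open>0\<close>; only upper bounds on degrees matter.\<close>

definition mpoly_degree :: "'v mpoly \<Rightarrow> nat" where
  "mpoly_degree f = Max (insert 0 ((\<lambda>m. \<Sum>v\<in>Poly_Mapping.keys m. Poly_Mapping.lookup m v) ` Poly_Mapping.keys f))"

definition mpolys_upto :: "nat \<Rightarrow> 'v set \<Rightarrow> 'v mpoly set" where
  "mpolys_upto k V = {f. mpoly_vars f \<subseteq> V \<and> mpoly_degree f \<le> k}"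


section \<open>Splines\<close>

definition partition_cell ::
  "'v set \<Rightarrow> nat \<Rightarrow> (nat \<Rightarrow> 'v mpoly) \<Rightarrow> (nat \<Rightarrow> real) \<Rightarrow> ('v \<Rightarrow> real) set" where
  "partition_cell V b \<pi> \<theta> =
     {x \<in> V \<rightarrow>\<^sub>E UNIV. \<forall>i\<in>{1..b}. sgn (mpoly_eval x (\<pi> i)) = \<theta> i}"

definition splines ::
  "nat \<Rightarrow> 'v set \<Rightarrow> nat \<Rightarrow> (nat \<Rightarrow> 'v mpoly) \<Rightarrow> (('v \<Rightarrow> real) \<Rightarrow> real) set" where
  "splines k V b \<pi> =
     {f. continuous_map (powertop_real V) euclideanreal f \<and>
         (\<forall>i\<in>{1..b}. \<pi> i \<in> mpolys_upto k V) \<and>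
         (\<forall>\<theta> \<in> {1..b} \<rightarrow> {1, 0, -1}. partition_cell V b \<pi> \<theta> \<noteq> {} \<longrightarrow>
            (\<exists>q \<in> mpolys_upto k V. \<forall>x \<in> partition_cell V b \<pi> \<theta>. f x = mpoly_eval x q))}"

text \<open>\<open>dec\<close> turns a point (a family of entries) into the argument of the map \<open>F\<close>.\<close>

definition spline_map ::
  "nat \<Rightarrow> 'v set \<Rightarrow> (('v \<Rightarrow> real) \<Rightarrow> 'x) \<Rightarrow> nat \<Rightarrow> nat \<Rightarrow> ('x \<Rightarrow> real mat) \<Rightarrow> bool" where
  "spline_map k V dec m q F \<longleftrightarrow>
     (\<forall>x \<in> V \<rightarrow>\<^sub>E UNIV. F (dec x) \<in> carrier_mat m q) \<and>
     (\<exists>b \<pi>. \<forall>i<m. \<forall>j<q. (\<lambda>x. F (dec x) $$ (i, j)) \<in> splines k V b \<pi>)"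

text \<open>\<open>F\<close> maps \<open>n \<times> p\<close> matrices to \<open>m \<times> p\<close> matrices.\<close>

definition matrix_spline :: "nat \<Rightarrow> nat \<Rightarrow> nat \<Rightarrow> nat \<Rightarrow> (real mat \<Rightarrow> real mat) \<Rightarrow> bool" where
  "matrix_spline k n m p F \<longleftrightarrow> spline_map k ({..<n} \<times> {..<p}) (mat n p) m p F"

text \<open>\<open>F\<close> maps pairs of an \<open>n \<times> p\<close> and an \<open>r \<times> p\<close> matrix to \<open>m \<times> p\<close> matrices.\<close>

definition matrix_pair_spline ::
  "nat \<Rightarrow> nat \<Rightarrow> nat \<Rightarrow> nat \<Rightarrow> nat \<Rightarrow> (real mat \<times> real mat \<Rightarrow> real mat) \<Rightarrow> bool" where
  "matrix_pair_spline k n r m p F \<longleftrightarrow>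
     spline_map k (({..<n} \<times> {..<p}) <+> ({..<r} \<times> {..<p}))
       (\<lambda>x. (mat n p (\<lambda>ij. x (Inl ij)), mat r p (\<lambda>ij. x (Inr ij)))) m p F"


section \<open>Neural networks\<close>

definition relu :: "real \<Rightarrow> real" where
  "relu x = max x 0"

fun hidden_layers ::
  "(nat \<Rightarrow> real mat) \<Rightarrow> (nat \<Rightarrow> real vec) \<Rightarrow> nat \<Rightarrow> real vec \<Rightarrow> real vec" where
  "hidden_layers A b 0 x = x"
| "hidden_layers A b (Suc i) x =
     map_vec relu (A (Suc i) *\<^sub>v hidden_layers A b i x + b (Suc i))"

definition neural_network :: "nat \<Rightarrow> nat \<Rightarrow> nat \<Rightarrow> (real vec \<Rightarrow> real vec) \<Rightarrow> bool" where
  "neural_network l n m \<phi> \<longleftrightarrow>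
     (\<exists>N A b. N 0 = n \<and> N (l + 1) = m \<and>
        (\<forall>i\<in>{1..l + 1}. A i \<in> carrier_mat (N i) (N (i - 1)) \<and> b i \<in> carrier_vec (N i)) \<and>
        (\<forall>x \<in> carrier_vec n.
           \<phi> x = A (l + 1) *\<^sub>v hidden_layers A b l x + b (l + 1)))"

text \<open>The action on the columns of a matrix; \<open>m\<close> is the output dimension of \<open>\<phi>\<close>.\<close>

definition columnwise :: "nat \<Rightarrow> (real vec \<Rightarrow> real vec) \<Rightarrow> real mat \<Rightarrow> real mat" where
  "columnwise m \<phi> X = mat_of_cols m (map \<phi> (cols X))"


section \<open>Attention modules\<close>

text \<open>Maps between spaces of matrices are constrained only on matrices of the right dimensions;
  their values elsewhere are irrelevant.\<close>

definition single_head_attention ::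
  "nat \<Rightarrow> nat \<Rightarrow> nat \<Rightarrow> (real mat \<Rightarrow> real mat) \<Rightarrow> bool" where
  "single_head_attention n p m \<alpha> \<longleftrightarrow>
     (\<exists>d A\<^sub>Q A\<^sub>K A\<^sub>V B\<^sub>Q B\<^sub>K B\<^sub>V.
        A\<^sub>Q \<in> carrier_mat d n \<and> A\<^sub>K \<in> carrier_mat d n \<and> A\<^sub>V \<in> carrier_mat m n \<and>
        B\<^sub>Q \<in> carrier_mat d p \<and> B\<^sub>K \<in> carrier_mat d p \<and> B\<^sub>V \<in> carrier_mat m p \<and>
        (\<forall>X \<in> carrier_mat n p.
           \<alpha> X = (A\<^sub>V * X + B\<^sub>V) *
             map_mat relu (transpose_mat (A\<^sub>K * X + B\<^sub>K) * (A\<^sub>Q * X + B\<^sub>Q))))"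

definition mask :: "real mat \<Rightarrow> ereal mat" where
  "mask M = mat (dim_row M) (dim_col M) (\<lambda>(i, j). if i \<le> j then ereal (M $$ (i, j)) else -\<infinity>)"

text \<open>ReLU on \<open>\<real> \<union> {-\<infinity>}\<close>; in particular \<open>-\<infinity>\<close> is sent to \<open>0\<close>.\<close>

definition relu_ext :: "ereal \<Rightarrow> real" where
  "relu_ext x = real_of_ereal (max x 0)"

definition single_head_masked_attention ::
  "nat \<Rightarrow> nat \<Rightarrow> nat \<Rightarrow> (real mat \<Rightarrow> real mat) \<Rightarrow> bool" where
  "single_head_masked_attention n p m \<beta> \<longleftrightarrow>
     (\<exists>d A\<^sub>Q A\<^sub>K A\<^sub>V B\<^sub>Q B\<^sub>K B\<^sub>V.
        A\<^sub>Q \<in> carrier_mat d n \<and> A\<^sub>K \<in> carrier_mat d n \<and> A\<^sub>V \<in> carrier_mat m n \<and>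
        B\<^sub>Q \<in> carrier_mat d p \<and> B\<^sub>K \<in> carrier_mat d p \<and> B\<^sub>V \<in> carrier_mat m p \<and>
        (\<forall>X \<in> carrier_mat n p.
           \<beta> X = (A\<^sub>V * X + B\<^sub>V) *
             map_mat relu_ext (mask (transpose_mat (A\<^sub>K * X + B\<^sub>K) * (A\<^sub>Q * X + B\<^sub>Q)))))"

definition single_head_encdec_attention ::
  "nat \<Rightarrow> nat \<Rightarrow> nat \<Rightarrow> nat \<Rightarrow> (real mat \<times> real mat \<Rightarrow> real mat) \<Rightarrow> bool" where
  "single_head_encdec_attention n r p m \<gamma> \<longleftrightarrow>
     (\<exists>d A\<^sub>Q A\<^sub>K A\<^sub>V B\<^sub>Q B\<^sub>K B\<^sub>V.
        A\<^sub>Q \<in> carrier_mat d r \<and> A\<^sub>K \<in> carrier_mat d n \<and> A\<^sub>V \<in> carrier_mat m n \<and>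
        B\<^sub>Q \<in> carrier_mat d p \<and> B\<^sub>K \<in> carrier_mat d p \<and> B\<^sub>V \<in> carrier_mat m p \<and>
        (\<forall>X \<in> carrier_mat n p. \<forall>Y \<in> carrier_mat r p.
           \<gamma> (X, Y) = (A\<^sub>V * X + B\<^sub>V) *
             map_mat relu (transpose_mat (A\<^sub>K * X + B\<^sub>K) * (A\<^sub>Q * Y + B\<^sub>Q))))"

definition stack_rows :: "nat \<Rightarrow> real mat list \<Rightarrow> real mat" where
  "stack_rows p Ms = foldr (@\<^sub>r) Ms (0\<^sub>m 0 p)"

text \<open>\<open>single m\<close> is the predicate of being a single-head module with \<open>m\<close> output rows, \<open>D\<close> is the
  set of inputs. The heads may have different numbers \<open>\<mu> i\<close> of output rows, and \<open>h = 1\<close>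
  gives back the single-head modules.\<close>

definition multihead ::
  "(nat \<Rightarrow> ('x \<Rightarrow> real mat) \<Rightarrow> bool) \<Rightarrow> 'x set \<Rightarrow> nat \<Rightarrow> nat \<Rightarrow> nat \<Rightarrow> ('x \<Rightarrow> real mat) \<Rightarrow> bool" where
  "multihead single D h p m F \<longleftrightarrow> h \<ge> 1 \<and>
     (\<exists>\<mu> f. (\<forall>i<h. single (\<mu> i) (f i)) \<and> m = (\<Sum>i<h. \<mu> i) \<and>
        (\<forall>x\<in>D. F x = stack_rows p (map (\<lambda>i. f i x) [0..<h])))"

definition attention_module :: "nat \<Rightarrow> nat \<Rightarrow> nat \<Rightarrow> (real mat \<Rightarrow> real mat) \<Rightarrow> bool" where
  "attention_module n p m \<alpha> \<longleftrightarrow>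
     (\<exists>h. multihead (single_head_attention n p) (carrier_mat n p) h p m \<alpha>)"

definition masked_attention_module :: "nat \<Rightarrow> nat \<Rightarrow> nat \<Rightarrow> (real mat \<Rightarrow> real mat) \<Rightarrow> bool" where
  "masked_attention_module n p m \<beta> \<longleftrightarrow>
     (\<exists>h. multihead (single_head_masked_attention n p) (carrier_mat n p) h p m \<beta>)"

definition encdec_attention_module ::
  "nat \<Rightarrow> nat \<Rightarrow> nat \<Rightarrow> nat \<Rightarrow> (real mat \<times> real mat \<Rightarrow> real mat) \<Rightarrow> bool" where
  "encdec_attention_module n r p m \<gamma> \<longleftrightarrow>
     (\<exists>h. multihead (single_head_encdec_attention n r p)
            (carrier_mat n p \<times> carrier_mat r p) h p m \<gamma>)"


section \<open>Encoders, decoders and encoder-decoders\<close>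

definition encoder_block :: "nat \<Rightarrow> nat \<Rightarrow> nat \<Rightarrow> (real mat \<Rightarrow> real mat) \<Rightarrow> bool" where
  "encoder_block n p m \<epsilon> \<longleftrightarrow>
     (\<exists>q l \<alpha> \<phi>. attention_module n p q \<alpha> \<and> neural_network l q m \<phi> \<and>
        (\<forall>X \<in> carrier_mat n p. \<epsilon> X = columnwise m \<phi> (\<alpha> X)))"

definition decoder_block :: "nat \<Rightarrow> nat \<Rightarrow> nat \<Rightarrow> (real mat \<Rightarrow> real mat) \<Rightarrow> bool" where
  "decoder_block n p m \<delta> \<longleftrightarrow>
     (\<exists>q l \<beta> \<phi>. masked_attention_module n p q \<beta> \<and> neural_network l q m \<phi> \<and>
        (\<forall>X \<in> carrier_mat n p. \<delta> X = columnwise m \<phi> (\<beta> X)))"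

definition encdec_block ::
  "nat \<Rightarrow> nat \<Rightarrow> nat \<Rightarrow> nat \<Rightarrow> (real mat \<times> real mat \<Rightarrow> real mat) \<Rightarrow> bool" where
  "encdec_block n r p m \<tau> \<longleftrightarrow>
     (\<exists>q u l \<beta> \<gamma> \<phi>. masked_attention_module r p q \<beta> \<and> encdec_attention_module n q p u \<gamma> \<and>
        neural_network l u m \<phi> \<and>
        (\<forall>X \<in> carrier_mat n p. \<forall>Y \<in> carrier_mat r p.
           \<tau> (X, Y) = columnwise m \<phi> (\<gamma> (X, \<beta> Y))))"

text \<open>\<open>block_stack p ks n m F\<close>: \<open>F\<close> is a composition of \<open>length ks\<close> blocks, from \<open>n \<times> p\<close> to
  \<open>m \<times> p\<close> matrices. The list \<open>ks\<close> tells, from the outermost block inwards, whether the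
  attention module of the block is masked. The empty composition is the identity.\<close>

inductive block_stack :: "nat \<Rightarrow> bool list \<Rightarrow> nat \<Rightarrow> nat \<Rightarrow> (real mat \<Rightarrow> real mat) \<Rightarrow> bool"
  for p :: nat where
  empty: "(\<forall>X \<in> carrier_mat n p. F X = X) \<Longrightarrow> block_stack p [] n n F"
| encoder: "block_stack p ks n u F \<Longrightarrow> encoder_block u p m \<epsilon> \<Longrightarrow>
     (\<forall>X \<in> carrier_mat n p. G X = \<epsilon> (F X)) \<Longrightarrow> block_stack p (False # ks) n m G"
| decoder: "block_stack p ks n u F \<Longrightarrow> decoder_block u p m \<delta> \<Longrightarrow>
     (\<forall>X \<in> carrier_mat n p. G X = \<delta> (F X)) \<Longrightarrow> block_stack p (True # ks) n m G"

definition layered_encoder ::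
  "nat \<Rightarrow> nat \<Rightarrow> nat \<Rightarrow> nat \<Rightarrow> (real mat \<Rightarrow> real mat) \<Rightarrow> bool" where
  "layered_encoder t n p m F \<longleftrightarrow> block_stack p (replicate t False) n m F"

text \<open>Some or all of the attention modules are masked.\<close>

definition layered_decoder ::
  "nat \<Rightarrow> nat \<Rightarrow> nat \<Rightarrow> nat \<Rightarrow> (real mat \<Rightarrow> real mat) \<Rightarrow> bool" where
  "layered_decoder t n p m F \<longleftrightarrow>
     (\<exists>ks. length ks = t \<and> True \<in> set ks \<and> block_stack p ks n m F)"

text \<open>The recursion for \<open>\<tau>\<^sub>i\<close>, given the encoder \<open>E\<close> from \<open>n \<times> p\<close> to \<open>e \<times> p\<close> matrices. The
  step \<open>\<tau>\<^sub>i (X, Y) = \<phi>\<^sub>i (\<gamma>\<^sub>i (E X, \<beta>\<^sub>i (\<tau>\<^sub>i\<^sub>-\<^sub>1 (X, Y))))\<close> is an encoder-decoder block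
  applied to \<open>(E X, \<tau>\<^sub>i\<^sub>-\<^sub>1 (X, Y))\<close>.\<close>

inductive encdec_layers ::
  "nat \<Rightarrow> nat \<Rightarrow> nat \<Rightarrow> nat \<Rightarrow> (real mat \<Rightarrow> real mat) \<Rightarrow> nat \<Rightarrow> nat \<Rightarrow>
   (real mat \<times> real mat \<Rightarrow> real mat) \<Rightarrow> bool"
  for n e r p :: nat and E :: "real mat \<Rightarrow> real mat" where
  zero: "(\<forall>X \<in> carrier_mat n p. \<forall>Y \<in> carrier_mat r p. T (X, Y) = Y) \<Longrightarrow>
     encdec_layers n e r p E 0 r T"
| step: "encdec_layers n e r p E t u T \<Longrightarrow> encdec_block e u p m \<tau> \<Longrightarrow>
     (\<forall>X \<in> carrier_mat n p. \<forall>Y \<in> carrier_mat r p. T' (X, Y) = \<tau> (E X, T (X, Y))) \<Longrightarrow>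
     encdec_layers n e r p E (Suc t) m T'"

definition encoder_decoder ::
  "nat \<Rightarrow> nat \<Rightarrow> nat \<Rightarrow> nat \<Rightarrow> nat \<Rightarrow> nat \<Rightarrow> (real mat \<times> real mat \<Rightarrow> real mat) \<Rightarrow> bool" where
  "encoder_decoder s t n r p m T \<longleftrightarrow>
     (\<exists>e E. layered_encoder s n p e E \<and> encdec_layers n e r p E t m T)"

end

theory Submission
  imports Defs
begin

text \<open>Splines of unspecified partition are closed under sums (maximum of the degrees), products
  (sum of the degrees) and ReLU (same degree: the finitely many polynomials occurring on the
  cells are added to the partition). Hence a neural network does not raise the degree, and if
  the entries of \<open>X\<close> and \<open>Y\<close> are splines of degrees \<open>a\<close> and \<open>b\<close>, those of
  \<open>V(X) ReLU(K(X)\<^sup>T Q(Y))\<close> are splines of degree \<open>2a + b\<close>. Propagating degrees of entries avoids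
  composing splines, and yields the recursion \<open>d\<^sub>t = 2 \<cdot> 3\<^sup>s + 3 d\<^sub>t\<^sub>-\<^sub>1\<close>, \<open>d\<^sub>0 = 1\<close>, for
  encoder-decoders.\<close>

section \<open>Polynomial functions of bounded degree\<close>

definition monomial_eval :: "('v \<Rightarrow> real) \<Rightarrow> ('v \<Rightarrow>\<^sub>0 nat) \<Rightarrow> real" where
  "monomial_eval x m = (\<Prod>v\<in>Poly_Mapping.keys m. x v ^ Poly_Mapping.lookup m v)"

definition monomial_degree :: "('v \<Rightarrow>\<^sub>0 nat) \<Rightarrow> nat" where
  "monomial_degree m = (\<Sum>v\<in>Poly_Mapping.keys m. Poly_Mapping.lookup m v)"

definition monomials_upto :: "nat \<Rightarrow> 'v set \<Rightarrow> ('v \<Rightarrow>\<^sub>0 nat) set" where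
  "monomials_upto k V = {m. Poly_Mapping.keys m \<subseteq> V \<and> monomial_degree m \<le> k}"

text \<open>Variables outside the keys have exponent 0 and contribute a factor 1, so two monomials
  can be evaluated over one common index set.\<close>

lemma monomial_eval_superset:
  assumes "finite A" "Poly_Mapping.keys m \<subseteq> A"
  shows "monomial_eval x m = (\<Prod>v\<in>A. x v ^ Poly_Mapping.lookup m v)"
  unfolding monomial_eval_def
  by (rule prod.mono_neutral_left) (use assms in \<open>auto simp: in_keys_iff\<close>)

lemma monomial_degree_superset:
  assumes "finite A" "Poly_Mapping.keys m \<subseteq> A"
  shows "monomial_degree m = (\<Sum>v\<in>A. Poly_Mapping.lookup m v)"
  unfolding monomial_degree_def
  by (rule sum.mono_neutral_left) (use assms in \<open>auto simp: in_keys_iff\<close>)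

lemma monomial_eval_add: "monomial_eval x (m + m') = monomial_eval x m * monomial_eval x m'"
proof -
  let ?A = "Poly_Mapping.keys m \<union> Poly_Mapping.keys m'"
  have "Poly_Mapping.keys (m + m') \<subseteq> ?A" by (rule keys_add)
  then show ?thesis
    by (simp add: monomial_eval_superset[of ?A] lookup_add power_add prod.distrib)
qed

lemma monomial_degree_add: "monomial_degree (m + m') = monomial_degree m + monomial_degree m'"
proof -
  let ?A = "Poly_Mapping.keys m \<union> Poly_Mapping.keys m'"
  have "Poly_Mapping.keys (m + m') \<subseteq> ?A" by (rule keys_add)
  then show ?thesis
    by (simp add: monomial_degree_superset[of ?A] lookup_add sum.distrib)
qed

lemma monomials_upto_add:
  assumes "m \<in> monomials_upto j V" "m' \<in> monomials_upto k V"
  shows "m + m' \<in> monomials_upto (j + k) V"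
  using assms keys_add[of m m'] unfolding monomials_upto_def monomial_degree_add mem_Collect_eq
  by (meson Un_least add_mono subset_trans)

lemma mpoly_eval_monomials:
  "mpoly_eval x f = (\<Sum>m\<in>Poly_Mapping.keys f. Poly_Mapping.lookup f m * monomial_eval x m)"
  by (simp add: mpoly_eval_def monomial_eval_def)

text \<open>Adding polynomials may cancel monomials, so sums are compared over the union of both key
  sets; a missing monomial has coefficient 0.\<close>

lemma mpoly_eval_superset:
  assumes "finite A" "Poly_Mapping.keys f \<subseteq> A"
  shows "mpoly_eval x f = (\<Sum>m\<in>A. Poly_Mapping.lookup f m * monomial_eval x m)"
  unfolding mpoly_eval_monomials
  by (rule sum.mono_neutral_left) (use assms in \<open>auto simp: in_keys_iff\<close>)

text \<open>The maximum of a finite set containing 0 is at most \<open>k\<close> exactly when each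
  element is. The bounds on variables and degree thus become one condition on each monomial.\<close>

lemma mpolys_upto_monomials: "f \<in> mpolys_upto k V \<longleftrightarrow> Poly_Mapping.keys f \<subseteq> monomials_upto k V"
  unfolding mpolys_upto_def mpoly_vars_def mpoly_degree_def monomials_upto_def
    monomial_degree_def[symmetric] by auto

lemma mpolys_upto_mono: "j \<le> k \<Longrightarrow> mpolys_upto j V \<subseteq> mpolys_upto k V"
  by (auto simp: mpolys_upto_def)

lemma mpoly_eval_add: "mpoly_eval x (f + g) = mpoly_eval x f + mpoly_eval x g"
proof -
  let ?A = "Poly_Mapping.keys f \<union> Poly_Mapping.keys g"
  have "Poly_Mapping.keys (f + g) \<subseteq> ?A" by (rule keys_add)
  then show ?thesis
    by (simp add: mpoly_eval_superset[of ?A] lookup_add algebra_simps sum.distrib)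
qed

text \<open>Functions take the place of polynomials, so that closure properties follow by rewriting
  values instead of computing with coefficients.\<close>

definition poly_fun :: "nat \<Rightarrow> 'v set \<Rightarrow> (('v \<Rightarrow> real) \<Rightarrow> real) \<Rightarrow> bool" where
  "poly_fun k V f \<longleftrightarrow> (\<exists>q\<in>mpolys_upto k V. \<forall>x. f x = mpoly_eval x q)"

lemma poly_fun_monomial:
  assumes "m \<in> monomials_upto k V"
  shows "poly_fun k V (\<lambda>x. c * monomial_eval x m)"
  unfolding poly_fun_def
  by (rule bexI[of _ "Poly_Mapping.single m c"])
    (use assms in \<open>auto simp: mpolys_upto_monomials mpoly_eval_monomials\<close>)

lemma poly_fun_add:
  assumes "poly_fun k V f" "poly_fun k V g"
  shows "poly_fun k V (\<lambda>x. f x + g x)"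
proof -
  from assms obtain q r where "q \<in> mpolys_upto k V" "r \<in> mpolys_upto k V"
    "\<forall>x. f x = mpoly_eval x q" "\<forall>x. g x = mpoly_eval x r"
    unfolding poly_fun_def by blast
  then show ?thesis
    unfolding poly_fun_def using keys_add[of q r]
    by (intro bexI[of _ "q + r"]) (auto simp: mpoly_eval_add mpolys_upto_monomials)
qed

lemma poly_fun_const: "poly_fun k V (\<lambda>x. c)"
  using poly_fun_monomial[of 0 k V c]
  by (simp add: monomials_upto_def monomial_degree_def monomial_eval_def)

lemma poly_fun_coord:
  assumes "v \<in> V" "1 \<le> k"
  shows "poly_fun k V (\<lambda>x. x v)"
  using poly_fun_monomial[of "Poly_Mapping.single v 1" k V 1] assms
  by (simp add: monomials_upto_def monomial_degree_def monomial_eval_def)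

lemma poly_fun_sum: "(\<And>i. i \<in> A \<Longrightarrow> poly_fun k V (f i)) \<Longrightarrow> poly_fun k V (\<lambda>x. \<Sum>i\<in>A. f i x)"
  by (induction A rule: infinite_finite_induct) (auto intro: poly_fun_const poly_fun_add)

text \<open>The product expands into a double sum of scaled monomials whose degrees add, so closure
  under sums suffices and no product of polynomials has to be formed.\<close>

lemma poly_fun_mult:
  assumes "poly_fun j V f" "poly_fun k V g"
  shows "poly_fun (j + k) V (\<lambda>x. f x * g x)"
proof -
  from assms obtain q r where q: "q \<in> mpolys_upto j V" "\<forall>x. f x = mpoly_eval x q"
    and r: "r \<in> mpolys_upto k V" "\<forall>x. g x = mpoly_eval x r"
    unfolding poly_fun_def by blast
  have "f x * g x = (\<Sum>m\<in>Poly_Mapping.keys q. \<Sum>m'\<in>Poly_Mapping.keys r.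
      (Poly_Mapping.lookup q m * Poly_Mapping.lookup r m') * monomial_eval x (m + m'))" for x
    by (simp add: q r mpoly_eval_monomials sum_product monomial_eval_add mult_ac)
  moreover have "poly_fun (j + k) V (\<lambda>x. \<Sum>m\<in>Poly_Mapping.keys q. \<Sum>m'\<in>Poly_Mapping.keys r.
      (Poly_Mapping.lookup q m * Poly_Mapping.lookup r m') * monomial_eval x (m + m'))"
    by (intro poly_fun_sum poly_fun_monomial monomials_upto_add)
      (use q r in \<open>auto simp: mpolys_upto_monomials\<close>)
  ultimately show ?thesis by simp
qed

lemma poly_fun_mono: "poly_fun j V f \<Longrightarrow> j \<le> k \<Longrightarrow> poly_fun k V f"
  unfolding poly_fun_def using mpolys_upto_mono by blast


section \<open>The algebra of splines\<close>

text \<open>An equivalence relation whose classes on the points are the nonempty cells of the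
  partition induced by \<open>P\<close>.\<close>

definition same_signs :: "'v mpoly set \<Rightarrow> ('v \<Rightarrow> real) \<Rightarrow> ('v \<Rightarrow> real) \<Rightarrow> bool" where
  "same_signs P x y \<longleftrightarrow> (\<forall>\<pi>\<in>P. sgn (mpoly_eval x \<pi>) = sgn (mpoly_eval y \<pi>))"

text \<open>A cell is represented by one of its points \<open>x\<close>, which avoids sign vectors
  and the case of an empty cell.\<close>

definition piecewise_poly ::
  "nat \<Rightarrow> 'v set \<Rightarrow> 'v mpoly set \<Rightarrow> (('v \<Rightarrow> real) \<Rightarrow> real) \<Rightarrow> bool" where
  "piecewise_poly k V P f \<longleftrightarrow>
     (\<forall>x\<in>V \<rightarrow>\<^sub>E UNIV. \<exists>q. poly_fun k V q \<and> (\<forall>y\<in>V \<rightarrow>\<^sub>E UNIV. same_signs P x y \<longrightarrow> f y = q y))"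

text \<open>The partition is an unordered finite set behind a quantifier, so that common refinements
  are plain unions.\<close>

definition spline_fun :: "nat \<Rightarrow> 'v set \<Rightarrow> (('v \<Rightarrow> real) \<Rightarrow> real) \<Rightarrow> bool" where
  "spline_fun k V f \<longleftrightarrow> continuous_map (powertop_real V) euclideanreal f \<and>
     (\<exists>P. finite P \<and> P \<subseteq> mpolys_upto k V \<and> piecewise_poly k V P f)"

lemma same_signs_subset: "same_signs Q x y \<Longrightarrow> P \<subseteq> Q \<Longrightarrow> same_signs P x y"
  unfolding same_signs_def by blast

text \<open>A larger set of polynomials only refines the cells.\<close>

lemma piecewise_poly_mono:
  "piecewise_poly j V P f \<Longrightarrow> j \<le> k \<Longrightarrow> P \<subseteq> Q \<Longrightarrow> piecewise_poly k V Q f"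
  unfolding piecewise_poly_def by (blast intro: poly_fun_mono dest: same_signs_subset)

lemma piecewise_polyE:
  assumes "piecewise_poly k V P f" "x \<in> V \<rightarrow>\<^sub>E UNIV"
  obtains q where "q \<in> mpolys_upto k V"
    "\<And>y. y \<in> V \<rightarrow>\<^sub>E UNIV \<Longrightarrow> same_signs P x y \<Longrightarrow> f y = mpoly_eval y q"
proof -
  from assms obtain g where g: "poly_fun k V g"
    "\<forall>y\<in>V \<rightarrow>\<^sub>E UNIV. same_signs P x y \<longrightarrow> f y = g y"
    unfolding piecewise_poly_def by blast
  from g(1) obtain q where "q \<in> mpolys_upto k V" "\<forall>y. g y = mpoly_eval y q"
    unfolding poly_fun_def by blast
  with g(2) show thesis by (intro that[of q]) simp_all
qed

section \<open>Closure of splines under sums and products\<close>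

lemma spline_fun_cong:
  assumes "spline_fun k V f" "\<And>x. x \<in> V \<rightarrow>\<^sub>E UNIV \<Longrightarrow> g x = f x"
  shows "spline_fun k V g"
proof -
  from assms(1) obtain P where P: "continuous_map (powertop_real V) euclideanreal f"
    "finite P" "P \<subseteq> mpolys_upto k V" "piecewise_poly k V P f"
    unfolding spline_fun_def by blast
  have "continuous_map (powertop_real V) euclideanreal g"
    by (rule continuous_map_eq[OF P(1)]) (simp add: assms(2))
  moreover have "piecewise_poly k V P g"
    using P(4) assms(2) unfolding piecewise_poly_def by simp
  ultimately show ?thesis using P unfolding spline_fun_def by blast
qed

text \<open>Without polynomials in the partition the whole space is one cell. Continuity is assumed
  because only constants and coordinates are fed in; other splines inherit it from the closure
  lemmas.\<close>

lemma spline_fun_poly: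
  "poly_fun k V f \<Longrightarrow> continuous_map (powertop_real V) euclideanreal f \<Longrightarrow> spline_fun k V f"
  unfolding spline_fun_def piecewise_poly_def by (auto intro!: exI[of _ "{}"])

lemma spline_fun_const: "spline_fun k V (\<lambda>x. c)"
  by (intro spline_fun_poly poly_fun_const) simp

lemma spline_fun_coord: "v \<in> V \<Longrightarrow> 1 \<le> k \<Longrightarrow> spline_fun k V (\<lambda>x. x v)"
  by (intro spline_fun_poly poly_fun_coord continuous_map_product_projection)

text \<open>The union of both partitions refines each of them, and the larger degree bounds all its
  polynomials.\<close>

lemma spline_fun_common_partition:
  assumes "spline_fun j V f" "spline_fun k V g"
  obtains P where "finite P" "P \<subseteq> mpolys_upto (max j k) V"
    "piecewise_poly j V P f" "piecewise_poly k V P g"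
proof -
  from assms obtain P Q where *: "finite P" "P \<subseteq> mpolys_upto j V" "piecewise_poly j V P f"
    "finite Q" "Q \<subseteq> mpolys_upto k V" "piecewise_poly k V Q g"
    unfolding spline_fun_def by blast
  moreover have "mpolys_upto j V \<subseteq> mpolys_upto (max j k) V"
    "mpolys_upto k V \<subseteq> mpolys_upto (max j k) V"
    by (simp_all add: mpolys_upto_mono)
  ultimately show thesis
    using that[of "P \<union> Q"] piecewise_poly_mono[OF *(3) order_refl]
      piecewise_poly_mono[OF *(6) order_refl] by blast
qed

lemma spline_fun_add:
  assumes f: "spline_fun k V f" and g: "spline_fun k V g"
  shows "spline_fun k V (\<lambda>x. f x + g x)"
proof -
  obtain P where P: "finite P" "P \<subseteq> mpolys_upto (max k k) V"
    "piecewise_poly k V P f" "piecewise_poly k V P g"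
    using spline_fun_common_partition[OF f g] .
  have "piecewise_poly k V P (\<lambda>x. f x + g x)"
    unfolding piecewise_poly_def
  proof
    fix x :: "'a \<Rightarrow> real" assume x: "x \<in> V \<rightarrow>\<^sub>E UNIV"
    obtain q r where "poly_fun k V q" "\<forall>y\<in>V \<rightarrow>\<^sub>E UNIV. same_signs P x y \<longrightarrow> f y = q y"
      "poly_fun k V r" "\<forall>y\<in>V \<rightarrow>\<^sub>E UNIV. same_signs P x y \<longrightarrow> g y = r y"
      using P(3,4) x unfolding piecewise_poly_def by meson
    then show "\<exists>q. poly_fun k V q \<and>
        (\<forall>y\<in>V \<rightarrow>\<^sub>E UNIV. same_signs P x y \<longrightarrow> f y + g y = q y)"
      by (intro exI[of _ "\<lambda>y. q y + r y"]) (simp add: poly_fun_add)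
  qed
  with P f g show ?thesis
    unfolding spline_fun_def by (auto intro: continuous_map_add)
qed

lemma spline_fun_mult:
  assumes f: "spline_fun j V f" and g: "spline_fun k V g"
  shows "spline_fun (j + k) V (\<lambda>x. f x * g x)"
proof -
  obtain P where P: "finite P" "P \<subseteq> mpolys_upto (max j k) V"
    "piecewise_poly j V P f" "piecewise_poly k V P g"
    using spline_fun_common_partition[OF f g] .
  \<comment> \<open>The common partition has degree \<open>max j k\<close>, which is at most
    \<open>j + k\<close>, so it is admissible for the product.\<close>
  have "P \<subseteq> mpolys_upto (j + k) V"
    using P(2) mpolys_upto_mono[of "max j k" "j + k" V] by auto
  moreover have "piecewise_poly (j + k) V P (\<lambda>x. f x * g x)"
    unfolding piecewise_poly_def
  proof
    fix x :: "'a \<Rightarrow> real" assume x: "x \<in> V \<rightarrow>\<^sub>E UNIV"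
    obtain q r where "poly_fun j V q" "\<forall>y\<in>V \<rightarrow>\<^sub>E UNIV. same_signs P x y \<longrightarrow> f y = q y"
      "poly_fun k V r" "\<forall>y\<in>V \<rightarrow>\<^sub>E UNIV. same_signs P x y \<longrightarrow> g y = r y"
      using P(3,4) x unfolding piecewise_poly_def by meson
    then show "\<exists>q. poly_fun (j + k) V q \<and>
        (\<forall>y\<in>V \<rightarrow>\<^sub>E UNIV. same_signs P x y \<longrightarrow> f y * g y = q y)"
      by (intro exI[of _ "\<lambda>y. q y * r y"]) (simp add: poly_fun_mult)
  qed
  ultimately show ?thesis
    using P(1) f g unfolding spline_fun_def by (auto intro: continuous_map_real_mult)
qed

lemma spline_fun_sum:
  "(\<And>i. i \<in> A \<Longrightarrow> spline_fun k V (f i)) \<Longrightarrow> spline_fun k V (\<lambda>x. \<Sum>i\<in>A. f i x)"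
  by (induction A rule: infinite_finite_induct) (auto intro: spline_fun_const spline_fun_add)

section \<open>Closure of splines under ReLU\<close>

lemma finite_sign_vectors:
  assumes "finite P"
  shows "finite ((\<lambda>x. \<lambda>\<pi>\<in>P. sgn (mpoly_eval x \<pi>)) ` X)"
proof (rule finite_subset)
  \<comment> \<open>A sign takes three values, and restriction to \<open>P\<close> makes the vectors
    extensional, so they lie in a finite function space.\<close>
  show "(\<lambda>x. \<lambda>\<pi>\<in>P. sgn (mpoly_eval x \<pi>)) ` X \<subseteq> P \<rightarrow>\<^sub>E {1, 0, -1}"
    by (auto simp: sgn_real_def)
qed (simp add: assms finite_PiE)

lemma same_signs_restrict:
  "same_signs P x y \<longleftrightarrow>
     (\<lambda>\<pi>\<in>P. sgn (mpoly_eval x \<pi>)) = (\<lambda>\<pi>\<in>P. sgn (mpoly_eval y \<pi>))"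
  unfolding same_signs_def restrict_def fun_eq_iff by auto

text \<open>Where \<open>f\<close> equals a polynomial \<open>q\<close>, adding \<open>q\<close> to
  the partition makes the sign of \<open>f\<close> constant on each refined cell, so ReLU returns
  \<open>q\<close> or 0 throughout. As \<open>q\<close> has degree at most \<open>k\<close>, the
  refinement is allowed.\<close>

lemma spline_fun_relu:
  assumes "spline_fun k V f"
  shows "spline_fun k V (\<lambda>x. relu (f x))"
proof -
  let ?E = "V \<rightarrow>\<^sub>E (UNIV :: real set)"
  from assms obtain P where P: "continuous_map (powertop_real V) euclideanreal f"
    "finite P" "P \<subseteq> mpolys_upto k V" "piecewise_poly k V P f"
    unfolding spline_fun_def by blast
  \<comment> \<open>\<open>sig x\<close> labels the cell of \<open>x\<close>. Polynomials are chosen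
    per label and not per point: there are finitely many labels, hence finitely many polynomials to
    add.\<close>
  define sig where "sig = (\<lambda>x. \<lambda>\<pi>\<in>P. sgn (mpoly_eval x \<pi>))"
  have "\<forall>s\<in>sig ` ?E. \<exists>q. q \<in> mpolys_upto k V \<and> (\<forall>y\<in>?E. sig y = s \<longrightarrow> f y = mpoly_eval y q)"
  proof
    fix s assume "s \<in> sig ` ?E"
    then obtain x where x: "x \<in> ?E" "s = sig x" by blast
    obtain q where "q \<in> mpolys_upto k V"
      "\<And>y. y \<in> ?E \<Longrightarrow> same_signs P x y \<Longrightarrow> f y = mpoly_eval y q"
      using piecewise_polyE[OF P(4) x(1)] by metis
    then show "\<exists>q. q \<in> mpolys_upto k V \<and> (\<forall>y\<in>?E. sig y = s \<longrightarrow> f y = mpoly_eval y q)"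
      unfolding same_signs_restrict x(2) sig_def by (intro exI[of _ q]) simp
  qed
  from bchoice[OF this] obtain q where q: "\<forall>s\<in>sig ` ?E. q s \<in> mpolys_upto k V"
      "\<forall>s\<in>sig ` ?E. \<forall>y\<in>?E. sig y = s \<longrightarrow> f y = mpoly_eval y (q s)"
    by blast
  define Q where "Q = P \<union> q ` sig ` ?E"
  have "finite Q"
    unfolding Q_def sig_def by (intro finite_UnI finite_imageI finite_sign_vectors P(2))
  moreover have "Q \<subseteq> mpolys_upto k V"
    unfolding Q_def using P(3) q(1) by blast
  moreover have "piecewise_poly k V Q (\<lambda>x. relu (f x))"
    unfolding piecewise_poly_def
  proof
    fix x assume x: "x \<in> ?E"
    let ?q = "q (sig x)"
    have f: "f y = mpoly_eval y ?q" "sgn (f y) = sgn (f x)" if "y \<in> ?E" "same_signs Q x y" for y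
    proof -
      \<comment> \<open>Equal signs on \<open>Q\<close> imply equal signs on \<open>P\<close>, hence
        the same label and the same polynomial.\<close>
      have sy: "sig y = sig x"
        using same_signs_subset[OF that(2), of P]
        unfolding Q_def sig_def by (simp add: same_signs_restrict)
      show fy: "f y = mpoly_eval y ?q"
        using q(2) that(1) sy x by blast
      have "f x = mpoly_eval x ?q"
        using q(2) x by blast
      \<comment> \<open>Since \<open>?q\<close> belongs to the refined partition, its sign, which is
        that of \<open>f\<close>, agrees at \<open>x\<close> and \<open>y\<close>.\<close>
      moreover have "?q \<in> Q" unfolding Q_def using x by blast
      ultimately show "sgn (f y) = sgn (f x)"
        using that(2) fy unfolding same_signs_def by simp
    qed
    show "\<exists>r. poly_fun k V r \<and> (\<forall>y\<in>?E. same_signs Q x y \<longrightarrow> relu (f y) = r y)"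
    \<comment> \<open>The sign at the representative \<open>x\<close> decides for the whole refined
      cell; zero and negative values both lead to the polynomial 0.\<close>
    proof (cases "f x > 0")
      case True
      have "poly_fun k V (\<lambda>y. mpoly_eval y ?q)"
        unfolding poly_fun_def using q(1) x by blast
      moreover have "relu (f y) = mpoly_eval y ?q" if "y \<in> ?E" "same_signs Q x y" for y
        using f[OF that] True unfolding relu_def by (auto simp: sgn_real_def split: if_splits)
      ultimately show ?thesis by blast
    next
      case False
      have "relu (f y) = 0" if "y \<in> ?E" "same_signs Q x y" for y
        using f(2)[OF that] False unfolding relu_def by (auto simp: sgn_real_def split: if_splits)
      then show ?thesis using poly_fun_const[of k V 0] by blast
    qed
  qed
  moreover have "continuous_map (powertop_real V) euclideanreal (\<lambda>x. relu (f x))"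
    unfolding relu_def by (intro continuous_map_real_max P(1)) simp
  ultimately show ?thesis unfolding spline_fun_def by blast
qed

text \<open>The way back to \<open>splines\<close>: the separate partitions of finitely many
  functions are merged into their union, on which every function stays piecewise polynomial.\<close>

lemma spline_fun_family:
  assumes "finite I" "\<And>i. i \<in> I \<Longrightarrow> spline_fun k V (f i)"
  shows "\<exists>b \<pi>. \<forall>i\<in>I. f i \<in> splines k V b \<pi>"
proof -
  have "\<forall>i\<in>I. \<exists>P. finite P \<and> P \<subseteq> mpolys_upto k V \<and> piecewise_poly k V P (f i)"
    using assms(2) unfolding spline_fun_def by blast
  from bchoice[OF this] obtain P where P:
    "\<forall>i\<in>I. finite (P i) \<and> P i \<subseteq> mpolys_upto k V \<and> piecewise_poly k V (P i) (f i)"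
    by blast
  define Q where "Q = (\<Union>i\<in>I. P i)"
  have "finite Q" unfolding Q_def using assms(1) P by blast
  \<comment> \<open>The enumeration starts at 1 to match the index range in
    \<open>splines\<close>.\<close>
  then obtain \<pi> where \<pi>: "bij_betw \<pi> {1..card Q} Q"
    using ex_bij_betw_nat_finite_1 by blast
  have "f i \<in> splines k V (card Q) \<pi>" if i: "i \<in> I" for i
    unfolding splines_def
  proof (intro CollectI conjI ballI impI)
    show "continuous_map (powertop_real V) euclideanreal (f i)"
      using assms(2)[OF i] unfolding spline_fun_def by blast
    show "\<pi> n \<in> mpolys_upto k V" if "n \<in> {1..card Q}" for n
      using bij_betwE[OF \<pi>] that P unfolding Q_def by blast
    fix \<theta> assume "partition_cell V (card Q) \<pi> \<theta> \<noteq> {}"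
    \<comment> \<open>Any point of the nonempty cell serves as the representative that
      \<open>piecewise_poly\<close> asks for.\<close>
    then obtain x where x: "x \<in> partition_cell V (card Q) \<pi> \<theta>" by blast
    have "piecewise_poly k V Q (f i)"
      using piecewise_poly_mono[of k V "P i" "f i" k Q] P i unfolding Q_def by blast
    moreover have "x \<in> V \<rightarrow>\<^sub>E UNIV" using x unfolding partition_cell_def by blast
    ultimately obtain q where q: "q \<in> mpolys_upto k V"
      "\<And>y. y \<in> V \<rightarrow>\<^sub>E UNIV \<Longrightarrow> same_signs Q x y \<Longrightarrow> f i y = mpoly_eval y q"
      using piecewise_polyE by metis
    have "same_signs Q x y" if "y \<in> partition_cell V (card Q) \<pi> \<theta>" for y
      unfolding same_signs_def
    proof
      fix \<pi>' assume "\<pi>' \<in> Q"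
      then obtain n where "n \<in> {1..card Q}" "\<pi>' = \<pi> n"
        using bij_betw_imp_surj_on[OF \<pi>] by blast
      then show "sgn (mpoly_eval x \<pi>') = sgn (mpoly_eval y \<pi>')"
        using that x unfolding partition_cell_def by simp
    qed
    then show "\<exists>q\<in>mpolys_upto k V. \<forall>x\<in>partition_cell V (card Q) \<pi> \<theta>. f i x = mpoly_eval x q"
      using q unfolding partition_cell_def by (intro bexI[of _ q]) auto
  qed
  then show ?thesis by blast
qed


section \<open>Matrices with spline entries\<close>

text \<open>The matrix depends on the underlying variables and not on an input matrix, so applying a
  further module is a mere substitution.\<close>

definition mat_spline ::
  "nat \<Rightarrow> 'v set \<Rightarrow> nat \<Rightarrow> nat \<Rightarrow> (('v \<Rightarrow> real) \<Rightarrow> real mat) \<Rightarrow> bool" where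
  "mat_spline k V m p M \<longleftrightarrow> (\<forall>x\<in>V \<rightarrow>\<^sub>E UNIV. M x \<in> carrier_mat m p) \<and>
     (\<forall>i<m. \<forall>j<p. spline_fun k V (\<lambda>x. M x $$ (i, j)))"

definition vec_spline ::
  "nat \<Rightarrow> 'v set \<Rightarrow> nat \<Rightarrow> (('v \<Rightarrow> real) \<Rightarrow> real vec) \<Rightarrow> bool" where
  "vec_spline k V m v \<longleftrightarrow> (\<forall>x\<in>V \<rightarrow>\<^sub>E UNIV. v x \<in> carrier_vec m) \<and>
     (\<forall>i<m. spline_fun k V (\<lambda>x. v x $ i))"

text \<open>Entry formulas usually rely on the dimensions, which are known only at points of the
  space; the formula \<open>f\<close> may differ from the entry elsewhere.\<close>

lemma mat_splineI:
  assumes "\<And>x. x \<in> V \<rightarrow>\<^sub>E UNIV \<Longrightarrow> M x \<in> carrier_mat m p"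
    and "\<And>i j x. i < m \<Longrightarrow> j < p \<Longrightarrow> x \<in> V \<rightarrow>\<^sub>E UNIV \<Longrightarrow> M x $$ (i, j) = f i j x"
    and "\<And>i j. i < m \<Longrightarrow> j < p \<Longrightarrow> spline_fun k V (f i j)"
  shows "mat_spline k V m p M"
  unfolding mat_spline_def
proof (intro conjI ballI allI impI)
  show "spline_fun k V (\<lambda>x. M x $$ (i, j))" if "i < m" "j < p" for i j
    by (rule spline_fun_cong[OF assms(3,2)]) (rule that)+
qed (rule assms(1))

lemma vec_splineI:
  assumes "\<And>x. x \<in> V \<rightarrow>\<^sub>E UNIV \<Longrightarrow> v x \<in> carrier_vec m"
    and "\<And>i x. i < m \<Longrightarrow> x \<in> V \<rightarrow>\<^sub>E UNIV \<Longrightarrow> v x $ i = f i x"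
    and "\<And>i. i < m \<Longrightarrow> spline_fun k V (f i)"
  shows "vec_spline k V m v"
  unfolding vec_spline_def
proof (intro conjI ballI allI impI)
  show "spline_fun k V (\<lambda>x. v x $ i)" if "i < m" for i
    by (rule spline_fun_cong[OF assms(3,2)]) (rule that)+
qed (rule assms(1))

lemma mat_spline_carrier: "mat_spline k V m p M \<Longrightarrow> x \<in> V \<rightarrow>\<^sub>E UNIV \<Longrightarrow> M x \<in> carrier_mat m p"
  by (simp add: mat_spline_def)

lemma mat_spline_entry:
  "mat_spline k V m p M \<Longrightarrow> i < m \<Longrightarrow> j < p \<Longrightarrow> spline_fun k V (\<lambda>x. M x $$ (i, j))"
  by (simp add: mat_spline_def)

lemma vec_spline_carrier: "vec_spline k V m v \<Longrightarrow> x \<in> V \<rightarrow>\<^sub>E UNIV \<Longrightarrow> v x \<in> carrier_vec m"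
  by (simp add: vec_spline_def)

lemma vec_spline_entry: "vec_spline k V m v \<Longrightarrow> i < m \<Longrightarrow> spline_fun k V (\<lambda>x. v x $ i)"
  by (simp add: vec_spline_def)

lemma mat_spline_cong:
  assumes "mat_spline k V m p M" "\<And>x. x \<in> V \<rightarrow>\<^sub>E UNIV \<Longrightarrow> N x = M x"
  shows "mat_spline k V m p N"
proof (rule mat_splineI)
  show "N x \<in> carrier_mat m p" if "x \<in> V \<rightarrow>\<^sub>E UNIV" for x
    using assms(2)[OF that] mat_spline_carrier[OF assms(1) that] by simp
  show "N x $$ (i, j) = M x $$ (i, j)" if "x \<in> V \<rightarrow>\<^sub>E UNIV" for i j x
    using assms(2)[OF that] by simp
qed (rule mat_spline_entry[OF assms(1)])

lemma vec_spline_cong: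
  assumes "vec_spline k V m v" "\<And>x. x \<in> V \<rightarrow>\<^sub>E UNIV \<Longrightarrow> w x = v x"
  shows "vec_spline k V m w"
proof (rule vec_splineI)
  show "w x \<in> carrier_vec m" if "x \<in> V \<rightarrow>\<^sub>E UNIV" for x
    using assms(2)[OF that] vec_spline_carrier[OF assms(1) that] by simp
  show "w x $ i = v x $ i" if "x \<in> V \<rightarrow>\<^sub>E UNIV" for i x
    using assms(2)[OF that] by simp
qed (rule vec_spline_entry[OF assms(1)])

text \<open>\<open>spline_map\<close> demands one partition for all entries; it exists because the
  set of index pairs is finite.\<close>

lemma spline_map_mat_spline:
  assumes "mat_spline k V m p (\<lambda>x. F (dec x))"
  shows "spline_map k V dec m p F"
proof -
  have "\<exists>b \<pi>. \<forall>ij\<in>{..<m} \<times> {..<p}. (\<lambda>x. F (dec x) $$ ij) \<in> splines k V b \<pi>"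
    by (rule spline_fun_family) (use assms in \<open>auto simp: mat_spline_def\<close>)
  then obtain b \<pi> where "\<forall>i<m. \<forall>j<p. (\<lambda>x. F (dec x) $$ (i, j)) \<in> splines k V b \<pi>"
    by auto
  then show ?thesis
    using mat_spline_carrier[OF assms] unfolding spline_map_def by blast
qed

section \<open>Matrix operations and stacking of heads\<close>

lemma mat_spline_const: "C \<in> carrier_mat m p \<Longrightarrow> mat_spline k V m p (\<lambda>x. C)"
  by (simp add: mat_spline_def spline_fun_const)

lemma mat_spline_add:
  assumes M: "mat_spline k V m p M" and N: "mat_spline k V m p N"
  shows "mat_spline k V m p (\<lambda>x. M x + N x)"
proof (rule mat_splineI)
  show "spline_fun k V (\<lambda>x. M x $$ (i, j) + N x $$ (i, j))" if "i < m" "j < p" for i j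
    by (intro spline_fun_add mat_spline_entry[OF M] mat_spline_entry[OF N] that)
  fix x :: "'a \<Rightarrow> real" assume x: "x \<in> V \<rightarrow>\<^sub>E UNIV"
  note c = mat_spline_carrier[OF M x] mat_spline_carrier[OF N x]
  then show "M x + N x \<in> carrier_mat m p" by simp
  show "(M x + N x) $$ (i, j) = M x $$ (i, j) + N x $$ (i, j)" if "i < m" "j < p" for i j
    using c that by simp
qed

lemma mat_spline_mult:
  assumes M: "mat_spline j V m n M" and N: "mat_spline k V n p N"
  shows "mat_spline (j + k) V m p (\<lambda>x. M x * N x)"
proof (rule mat_splineI)
  show "spline_fun (j + k) V (\<lambda>x. \<Sum>l<n. M x $$ (a, l) * N x $$ (l, b))" if "a < m" "b < p" for a b
    using that by (intro spline_fun_sum spline_fun_mult mat_spline_entry[OF M] mat_spline_entry[OF N]) auto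
  fix x :: "'a \<Rightarrow> real" assume x: "x \<in> V \<rightarrow>\<^sub>E UNIV"
  note c = mat_spline_carrier[OF M x] mat_spline_carrier[OF N x]
  then show "M x * N x \<in> carrier_mat m p" by simp
  show "(M x * N x) $$ (a, b) = (\<Sum>l<n. M x $$ (a, l) * N x $$ (l, b))" if "a < m" "b < p" for a b
    using c that by (auto simp: scalar_prod_def atLeast0LessThan intro!: sum.cong)
qed

lemma mat_spline_transpose:
  assumes M: "mat_spline k V m p M"
  shows "mat_spline k V p m (\<lambda>x. transpose_mat (M x))"
proof (rule mat_splineI)
  show "spline_fun k V (\<lambda>x. M x $$ (j, i))" if "i < p" "j < m" for i j
    by (intro mat_spline_entry[OF M] that)
  fix x :: "'a \<Rightarrow> real" assume x: "x \<in> V \<rightarrow>\<^sub>E UNIV"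
  note c = mat_spline_carrier[OF M x]
  then show "transpose_mat (M x) \<in> carrier_mat p m" by simp
  show "(transpose_mat (M x)) $$ (i, j) = M x $$ (j, i)" if "i < p" "j < m" for i j
    using c that by simp
qed

lemma mat_spline_affine:
  assumes "A \<in> carrier_mat m n" "B \<in> carrier_mat m p" "mat_spline k V n p M"
  shows "mat_spline k V m p (\<lambda>x. A * M x + B)"
  \<comment> \<open>A constant matrix has degree 0, so the product has degree
    \<open>0 + k\<close>.\<close>
  using mat_spline_mult[OF mat_spline_const[OF assms(1), of 0] assms(3)]
  by (simp add: mat_spline_add mat_spline_const[OF assms(2)])

lemma mat_spline_relu:
  assumes M: "mat_spline k V m p M"
  shows "mat_spline k V m p (\<lambda>x. map_mat relu (M x))"
proof (rule mat_splineI)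
  show "spline_fun k V (\<lambda>x. relu (M x $$ (i, j)))" if "i < m" "j < p" for i j
    by (intro spline_fun_relu mat_spline_entry[OF M] that)
  fix x :: "'a \<Rightarrow> real" assume x: "x \<in> V \<rightarrow>\<^sub>E UNIV"
  note c = mat_spline_carrier[OF M x]
  then show "map_mat relu (M x) \<in> carrier_mat m p" by simp
  show "(map_mat relu (M x)) $$ (i, j) = relu (M x $$ (i, j))" if "i < m" "j < p" for i j
    using c that by simp
qed

text \<open>Masked entries become \<open>-\<infinity>\<close> and then 0. Whether an entry is masked
  depends only on its position, so the conditional selects between two functions and not between
  values at a point.\<close>

lemma mat_spline_masked_relu:
  assumes M: "mat_spline k V m p M"
  shows "mat_spline k V m p (\<lambda>x. map_mat relu_ext (mask (M x)))"
proof (rule mat_splineI)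
  show "spline_fun k V (if i \<le> j then \<lambda>x. relu (M x $$ (i, j)) else (\<lambda>x. 0))"
    if "i < m" "j < p" for i j
    using that by (simp add: spline_fun_const spline_fun_relu[OF mat_spline_entry[OF M]])
  fix x :: "'a \<Rightarrow> real" assume x: "x \<in> V \<rightarrow>\<^sub>E UNIV"
  note c = mat_spline_carrier[OF M x]
  then show "map_mat relu_ext (mask (M x)) \<in> carrier_mat m p" by (auto simp: mask_def)
  show "map_mat relu_ext (mask (M x)) $$ (i, j) =
      (if i \<le> j then \<lambda>x. relu (M x $$ (i, j)) else (\<lambda>x. 0)) x" if "i < m" "j < p" for i j
    using c that by (auto simp: mask_def relu_ext_def relu_def max_def)
qed

lemma mat_spline_append_rows:
  assumes M: "mat_spline k V m p M" and N: "mat_spline k V n p N"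
  shows "mat_spline k V (m + n) p (\<lambda>x. M x @\<^sub>r N x)"
proof (rule mat_splineI)
  show "spline_fun k V (if i < m then \<lambda>x. M x $$ (i, j) else (\<lambda>x. N x $$ (i - m, j)))"
    if "i < m + n" "j < p" for i j
    using that mat_spline_entry[OF M] mat_spline_entry[OF N] by auto
  fix x :: "'a \<Rightarrow> real" assume x: "x \<in> V \<rightarrow>\<^sub>E UNIV"
  note c = mat_spline_carrier[OF M x] mat_spline_carrier[OF N x]
  then show "M x @\<^sub>r N x \<in> carrier_mat (m + n) p" by simp
  show "(M x @\<^sub>r N x) $$ (i, j) =
      (if i < m then \<lambda>x. M x $$ (i, j) else (\<lambda>x. N x $$ (i - m, j))) x"
    if "i < m + n" "j < p" for i j
    using c that by (auto simp: append_rows_def)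
qed

text \<open>An arbitrary index list makes the induction go through; the empty list gives the matrix
  with 0 rows.\<close>

lemma mat_spline_stack_rows:
  assumes "\<And>i. i \<in> set is \<Longrightarrow> mat_spline k V (\<mu> i) p (f i)"
  shows "mat_spline k V (\<Sum>i\<leftarrow>is. \<mu> i) p (\<lambda>x. stack_rows p (map (\<lambda>i. f i x) is))"
  using assms
proof (induction "is")
  case Nil
  show ?case by (simp add: stack_rows_def mat_spline_const)
next
  case (Cons i "is")
  then have "mat_spline k V (\<mu> i + (\<Sum>i\<leftarrow>is. \<mu> i)) p
      (\<lambda>x. f i x @\<^sub>r stack_rows p (map (\<lambda>i. f i x) is))"
    by (intro mat_spline_append_rows) auto
  then show ?case by (simp add: stack_rows_def)
qed

text \<open>The kind of module and its inputs are left abstract, so all three kinds of attention are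
  reduced to a single head here.\<close>

lemma mat_spline_multihead:
  assumes F: "multihead single D h p m F"
    and X: "\<And>x. x \<in> V \<rightarrow>\<^sub>E UNIV \<Longrightarrow> X x \<in> D"
    and single: "\<And>\<mu> f. single \<mu> f \<Longrightarrow> mat_spline k V \<mu> p (\<lambda>x. f (X x))"
  shows "mat_spline k V m p (\<lambda>x. F (X x))"
proof -
  from F obtain \<mu> f where *: "\<forall>i<h. single (\<mu> i) (f i)" "m = (\<Sum>i<h. \<mu> i)"
    "\<forall>x\<in>D. F x = stack_rows p (map (\<lambda>i. f i x) [0..<h])"
    unfolding multihead_def by blast
  have "mat_spline k V (\<Sum>i\<leftarrow>[0..<h]. \<mu> i) p (\<lambda>x. stack_rows p (map (\<lambda>i. f i (X x)) [0..<h]))"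
    by (rule mat_spline_stack_rows) (use *(1) single in auto)
  moreover have "(\<Sum>i\<leftarrow>[0..<h]. \<mu> i) = m"
    using *(2) by (simp add: interv_sum_list_conv_sum_set_nat atLeast0LessThan)
  ultimately have "mat_spline k V m p (\<lambda>x. stack_rows p (map (\<lambda>i. f i (X x)) [0..<h]))" by simp
  then show ?thesis
    by (rule mat_spline_cong) (simp add: *(3) X)
qed


section \<open>Degrees of neural networks and attention modules\<close>

lemma vec_spline_affine:
  assumes A: "A \<in> carrier_mat m n" and b: "b \<in> carrier_vec m" and v: "vec_spline k V n v"
  shows "vec_spline k V m (\<lambda>x. A *\<^sub>v v x + b)"
proof (rule vec_splineI)
  show "spline_fun k V (\<lambda>x. (\<Sum>l<n. A $$ (i, l) * v x $ l) + b $ i)" if "i < m" for i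
    \<comment> \<open>The weights count as splines of degree 0.\<close>
    using spline_fun_mult[OF spline_fun_const vec_spline_entry[OF v], of _ 0]
    by (intro spline_fun_add spline_fun_sum spline_fun_const) simp
  fix x :: "'a \<Rightarrow> real" assume x: "x \<in> V \<rightarrow>\<^sub>E UNIV"
  note c = vec_spline_carrier[OF v x]
  then show "A *\<^sub>v v x + b \<in> carrier_vec m" using A b by simp
  show "(A *\<^sub>v v x + b) $ i = (\<Sum>l<n. A $$ (i, l) * v x $ l) + b $ i" if "i < m" for i
    using A b c that by (auto simp: scalar_prod_def atLeast0LessThan intro!: sum.cong)
qed

lemma vec_spline_relu:
  assumes v: "vec_spline k V m v"
  shows "vec_spline k V m (\<lambda>x. map_vec relu (v x))"
proof (rule vec_splineI)
  show "spline_fun k V (\<lambda>x. relu (v x $ i))" if "i < m" for i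
    by (intro spline_fun_relu vec_spline_entry[OF v] that)
  fix x :: "'a \<Rightarrow> real" assume x: "x \<in> V \<rightarrow>\<^sub>E UNIV"
  note c = vec_spline_carrier[OF v x]
  then show "map_vec relu (v x) \<in> carrier_vec m" by simp
  show "map_vec relu (v x) $ i = relu (v x $ i)" if "i < m" for i
    using c that by simp
qed

text \<open>Affine maps and ReLU both preserve the degree, so the number of layers does not
  matter.\<close>

lemma vec_spline_neural_network:
  assumes \<phi>: "neural_network l n m \<phi>" and v: "vec_spline k V n v"
  shows "vec_spline k V m (\<lambda>x. \<phi> (v x))"
proof -
  from \<phi> obtain N A b where *: "N 0 = n" "N (l + 1) = m"
    "\<forall>i\<in>{1..l + 1}. A i \<in> carrier_mat (N i) (N (i - 1)) \<and> b i \<in> carrier_vec (N i)"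
    "\<forall>x \<in> carrier_vec n. \<phi> x = A (l + 1) *\<^sub>v hidden_layers A b l x + b (l + 1)"
    unfolding neural_network_def by blast
  \<comment> \<open>The bound on \<open>i\<close> keeps \<open>Suc i\<close> in the range where the
    dimensions of the weights are known. The output layer carries no ReLU and is treated
    afterwards.\<close>
  have "vec_spline k V (N i) (\<lambda>x. hidden_layers A b i (v x))" if "i \<le> l" for i
    using that
  proof (induction i)
    case 0
    show ?case using v *(1) by simp
  next
    case (Suc i)
    then show ?case
      using *(3)[rule_format, of "Suc i"] by (auto intro!: vec_spline_relu vec_spline_affine)
  qed
  then have "vec_spline k V m (\<lambda>x. A (l + 1) *\<^sub>v hidden_layers A b l (v x) + b (l + 1))"
    using *(2) *(3)[rule_format, of "l + 1"] by (auto intro!: vec_spline_affine)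
  then show ?thesis
    by (rule vec_spline_cong) (use vec_spline_carrier[OF v] *(4) in simp)
qed

text \<open>Column \<open>j\<close> of the output is the network applied to column \<open>j\<close>
  of the input.\<close>

lemma mat_spline_columnwise:
  assumes \<phi>: "neural_network l n m \<phi>" and M: "mat_spline k V n p M"
  shows "mat_spline k V m p (\<lambda>x. columnwise m \<phi> (M x))"
proof -
  have col: "vec_spline k V n (\<lambda>x. col (M x) j)" if "j < p" for j
  proof (rule vec_splineI)
    show "spline_fun k V (\<lambda>x. M x $$ (i, j))" if "i < n" for i
      by (rule mat_spline_entry[OF M that \<open>j < p\<close>])
    fix x :: "'a \<Rightarrow> real" assume x: "x \<in> V \<rightarrow>\<^sub>E UNIV"
    note c = mat_spline_carrier[OF M x]
    then show "col (M x) j \<in> carrier_vec n" by (auto intro: carrier_vecI)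
    show "col (M x) j $ i = M x $$ (i, j)" if "i < n" for i
      using c that \<open>j < p\<close> by simp
  qed
  show ?thesis
  proof (rule mat_splineI)
    show "spline_fun k V (\<lambda>x. \<phi> (col (M x) j) $ i)" if "i < m" "j < p" for i j
      by (intro vec_spline_entry[OF vec_spline_neural_network[OF \<phi>]] col that)
    fix x :: "'a \<Rightarrow> real" assume x: "x \<in> V \<rightarrow>\<^sub>E UNIV"
    note c = mat_spline_carrier[OF M x]
    show "columnwise m \<phi> (M x) \<in> carrier_mat m p"
      unfolding columnwise_def by (rule carrier_matI) (use c in auto)
    show "columnwise m \<phi> (M x) $$ (i, j) = \<phi> (col (M x) j) $ i" if "i < m" "j < p" for i j
      using c that by (simp add: columnwise_def mat_of_cols_index)
  qed
qed

lemma mat_spline_attention: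
  assumes X: "mat_spline k V n p X" and \<alpha>: "attention_module n p m \<alpha>"
  shows "mat_spline (3 * k) V m p (\<lambda>x. \<alpha> (X x))"
proof -
  obtain h where "multihead (single_head_attention n p) (carrier_mat n p) h p m \<alpha>"
    using \<alpha> unfolding attention_module_def by blast
  then show ?thesis
  proof (rule mat_spline_multihead)
    fix \<mu> f assume "single_head_attention n p \<mu> f"
    then obtain d A\<^sub>Q A\<^sub>K A\<^sub>V B\<^sub>Q B\<^sub>K B\<^sub>V where *:
      "A\<^sub>Q \<in> carrier_mat d n" "A\<^sub>K \<in> carrier_mat d n" "A\<^sub>V \<in> carrier_mat \<mu> n"
      "B\<^sub>Q \<in> carrier_mat d p" "B\<^sub>K \<in> carrier_mat d p" "B\<^sub>V \<in> carrier_mat \<mu> p"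
      and f: "\<And>X. X \<in> carrier_mat n p \<Longrightarrow> f X = (A\<^sub>V * X + B\<^sub>V) *
             map_mat relu (transpose_mat (A\<^sub>K * X + B\<^sub>K) * (A\<^sub>Q * X + B\<^sub>Q))"
      unfolding single_head_attention_def by blast
    \<comment> \<open>The sum is nested as the rules produce it: \<open>k\<close> from the value
      factor, \<open>k + k\<close> from keys times queries, unchanged by ReLU.\<close>
    have "mat_spline (k + (k + k)) V \<mu> p (\<lambda>x. (A\<^sub>V * X x + B\<^sub>V) *
        map_mat relu (transpose_mat (A\<^sub>K * X x + B\<^sub>K) * (A\<^sub>Q * X x + B\<^sub>Q)))"
      by (rule mat_spline_mult mat_spline_relu mat_spline_transpose mat_spline_affine X * )+
    then have "mat_spline (k + (k + k)) V \<mu> p (\<lambda>x. f (X x))"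
      by (rule mat_spline_cong) (simp add: f mat_spline_carrier[OF X])
    then show "mat_spline (3 * k) V \<mu> p (\<lambda>x. f (X x))" by (simp add: numeral_3_eq_3)
  qed (rule mat_spline_carrier[OF X])
qed

lemma mat_spline_masked_attention:
  assumes X: "mat_spline k V n p X" and \<beta>: "masked_attention_module n p m \<beta>"
  shows "mat_spline (3 * k) V m p (\<lambda>x. \<beta> (X x))"
proof -
  obtain h where "multihead (single_head_masked_attention n p) (carrier_mat n p) h p m \<beta>"
    using \<beta> unfolding masked_attention_module_def by blast
  then show ?thesis
  proof (rule mat_spline_multihead)
    fix \<mu> f assume "single_head_masked_attention n p \<mu> f"
    then obtain d A\<^sub>Q A\<^sub>K A\<^sub>V B\<^sub>Q B\<^sub>K B\<^sub>V where *:
      "A\<^sub>Q \<in> carrier_mat d n" "A\<^sub>K \<in> carrier_mat d n" "A\<^sub>V \<in> carrier_mat \<mu> n"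
      "B\<^sub>Q \<in> carrier_mat d p" "B\<^sub>K \<in> carrier_mat d p" "B\<^sub>V \<in> carrier_mat \<mu> p"
      and f: "\<And>X. X \<in> carrier_mat n p \<Longrightarrow> f X = (A\<^sub>V * X + B\<^sub>V) *
             map_mat relu_ext (mask (transpose_mat (A\<^sub>K * X + B\<^sub>K) * (A\<^sub>Q * X + B\<^sub>Q)))"
      unfolding single_head_masked_attention_def by blast
    have "mat_spline (k + (k + k)) V \<mu> p (\<lambda>x. (A\<^sub>V * X x + B\<^sub>V) *
        map_mat relu_ext (mask (transpose_mat (A\<^sub>K * X x + B\<^sub>K) * (A\<^sub>Q * X x + B\<^sub>Q))))"
      by (rule mat_spline_mult mat_spline_masked_relu mat_spline_transpose mat_spline_affine X * )+
    then have "mat_spline (k + (k + k)) V \<mu> p (\<lambda>x. f (X x))"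
      by (rule mat_spline_cong) (simp add: f mat_spline_carrier[OF X])
    then show "mat_spline (3 * k) V \<mu> p (\<lambda>x. f (X x))" by (simp add: numeral_3_eq_3)
  qed (rule mat_spline_carrier[OF X])
qed

text \<open>The first input enters through values and keys, the second only through queries.\<close>

lemma mat_spline_encdec_attention:
  assumes X: "mat_spline j V n p X" and Y: "mat_spline k V r p Y"
    and \<gamma>: "encdec_attention_module n r p m \<gamma>"
  shows "mat_spline (2 * j + k) V m p (\<lambda>x. \<gamma> (X x, Y x))"
proof -
  obtain h where "multihead (single_head_encdec_attention n r p)
      (carrier_mat n p \<times> carrier_mat r p) h p m \<gamma>"
    using \<gamma> unfolding encdec_attention_module_def by blast
  then show ?thesis
  proof (rule mat_spline_multihead)
    fix \<mu> f assume "single_head_encdec_attention n r p \<mu> f"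
    then obtain d A\<^sub>Q A\<^sub>K A\<^sub>V B\<^sub>Q B\<^sub>K B\<^sub>V where *:
      "A\<^sub>Q \<in> carrier_mat d r" "A\<^sub>K \<in> carrier_mat d n" "A\<^sub>V \<in> carrier_mat \<mu> n"
      "B\<^sub>Q \<in> carrier_mat d p" "B\<^sub>K \<in> carrier_mat d p" "B\<^sub>V \<in> carrier_mat \<mu> p"
      and f: "\<And>X Y. X \<in> carrier_mat n p \<Longrightarrow> Y \<in> carrier_mat r p \<Longrightarrow> f (X, Y) = (A\<^sub>V * X + B\<^sub>V) *
             map_mat relu (transpose_mat (A\<^sub>K * X + B\<^sub>K) * (A\<^sub>Q * Y + B\<^sub>Q))"
      unfolding single_head_encdec_attention_def by blast
    have "mat_spline (j + (j + k)) V \<mu> p (\<lambda>x. (A\<^sub>V * X x + B\<^sub>V) *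
        map_mat relu (transpose_mat (A\<^sub>K * X x + B\<^sub>K) * (A\<^sub>Q * Y x + B\<^sub>Q)))"
      by (rule mat_spline_mult mat_spline_relu mat_spline_transpose mat_spline_affine X Y * )+
    then have "mat_spline (j + (j + k)) V \<mu> p (\<lambda>x. f (X x, Y x))"
      by (rule mat_spline_cong) (simp add: f mat_spline_carrier[OF X] mat_spline_carrier[OF Y])
    then show "mat_spline (2 * j + k) V \<mu> p (\<lambda>x. f (X x, Y x))" by (simp add: mult_2 add_ac)
  qed (simp add: mat_spline_carrier[OF X] mat_spline_carrier[OF Y])
qed


section \<open>Degrees of encoders, decoders and encoder-decoders\<close>

lemma mat_spline_encoder_block:
  assumes X: "mat_spline k V n p X" and "encoder_block n p m \<epsilon>"
  shows "mat_spline (3 * k) V m p (\<lambda>x. \<epsilon> (X x))"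
proof -
  obtain q l \<alpha> \<phi> where *: "attention_module n p q \<alpha>" "neural_network l q m \<phi>"
    "\<forall>X \<in> carrier_mat n p. \<epsilon> X = columnwise m \<phi> (\<alpha> X)"
    using assms(2) unfolding encoder_block_def by blast
  show ?thesis
    by (rule mat_spline_cong[OF mat_spline_columnwise[OF *(2) mat_spline_attention[OF X *(1)]]])
      (simp add: *(3) mat_spline_carrier[OF X])
qed

lemma mat_spline_decoder_block:
  assumes X: "mat_spline k V n p X" and "decoder_block n p m \<delta>"
  shows "mat_spline (3 * k) V m p (\<lambda>x. \<delta> (X x))"
proof -
  obtain q l \<beta> \<phi> where *: "masked_attention_module n p q \<beta>" "neural_network l q m \<phi>"
    "\<forall>X \<in> carrier_mat n p. \<delta> X = columnwise m \<phi> (\<beta> X)"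
    using assms(2) unfolding decoder_block_def by blast
  show ?thesis
    by (rule mat_spline_cong[OF mat_spline_columnwise[OF *(2) mat_spline_masked_attention[OF X *(1)]]])
      (simp add: *(3) mat_spline_carrier[OF X])
qed

text \<open>Masked attention triples the degree of the second input before it reaches the queries;
  the network adds nothing.\<close>

lemma mat_spline_encdec_block:
  assumes X: "mat_spline j V n p X" and Y: "mat_spline k V r p Y"
    and "encdec_block n r p m \<tau>"
  shows "mat_spline (2 * j + 3 * k) V m p (\<lambda>x. \<tau> (X x, Y x))"
proof -
  obtain q u l \<beta> \<gamma> \<phi> where *: "masked_attention_module r p q \<beta>"
    "encdec_attention_module n q p u \<gamma>" "neural_network l u m \<phi>"
    "\<forall>X \<in> carrier_mat n p. \<forall>Y \<in> carrier_mat r p. \<tau> (X, Y) = columnwise m \<phi> (\<gamma> (X, \<beta> Y))"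
    using assms(3) unfolding encdec_block_def by blast
  show ?thesis
    by (rule mat_spline_cong[OF mat_spline_columnwise[OF *(3)
          mat_spline_encdec_attention[OF X mat_spline_masked_attention[OF Y *(1)] *(2)]]])
      (simp add: *(4) mat_spline_carrier[OF X] mat_spline_carrier[OF Y])
qed

text \<open>Each block triples the degree whether or not its attention is masked, so only the length
  of \<open>ks\<close> counts.\<close>

lemma mat_spline_block_stack:
  assumes "block_stack p ks n m F" and X: "mat_spline k V n p X"
  shows "mat_spline (3 ^ length ks * k) V m p (\<lambda>x. F (X x))"
  using assms
proof (induction rule: block_stack.induct)
  case (empty n F)
  show ?case
    by (rule mat_spline_cong[where M = X])
      (use empty.prems empty.hyps mat_spline_carrier[OF empty.prems] in simp_all)
next
  case (encoder ks n u F m \<epsilon> G)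
  show ?case
    by (rule mat_spline_cong[where M = "\<lambda>x. \<epsilon> (F (X x))"])
      (use mat_spline_encoder_block[OF encoder.IH[OF encoder.prems] encoder.hyps(2)]
        encoder.hyps(3) mat_spline_carrier[OF encoder.prems] in \<open>simp_all add: mult.assoc\<close>)
next
  case (decoder ks n u F m \<delta> G)
  show ?case
    by (rule mat_spline_cong[where M = "\<lambda>x. \<delta> (F (X x))"])
      (use mat_spline_decoder_block[OF decoder.IH[OF decoder.prems] decoder.hyps(2)]
        decoder.hyps(3) mat_spline_carrier[OF decoder.prems] in \<open>simp_all add: mult.assoc\<close>)
qed

text \<open>The closed form solves the recursion in which a layer turns degree \<open>d\<close> into
  \<open>2 * 3 ^ s + 3 * d\<close>.\<close>

lemma mat_spline_encdec_layers:
  assumes "encdec_layers n e r p E t m T"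
    and X: "mat_spline 1 V n p X" and Y: "mat_spline 1 V r p Y"
    and E: "mat_spline (3 ^ s) V e p (\<lambda>x. E (X x))"
  shows "mat_spline (3 ^ (t + s) + 3 ^ t - 3 ^ s) V m p (\<lambda>x. T (X x, Y x))"
  using assms(1)
proof (induction rule: encdec_layers.induct)
  case (zero T)
  \<comment> \<open>For \<open>t = 0\<close> the degree is \<open>3 ^ s + 1 - 3 ^ s = 1\<close>,
    that of the entries of \<open>Y\<close>.\<close>
  show ?case
    by (rule mat_spline_cong[where M = Y])
      (use Y zero mat_spline_carrier[OF X] mat_spline_carrier[OF Y] in simp_all)
next
  case (step t u T m \<tau> T')
  \<comment> \<open>Subtraction of naturals truncates; this inequality excludes that, so linear
    arithmetic can verify the recursion.\<close>
  have "(3::nat) ^ s \<le> 3 ^ (t + s)" by (simp add: power_increasing)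
  then have deg: "2 * 3 ^ s + 3 * (3 ^ (t + s) + 3 ^ t - 3 ^ s) =
      (3 ^ (Suc t + s) + 3 ^ Suc t - 3 ^ s :: nat)"
    unfolding add_Suc power_Suc by linarith
  show ?case
    unfolding deg[symmetric]
    by (rule mat_spline_cong[OF mat_spline_encdec_block[OF E step.IH step.hyps(2)]])
      (use step.hyps(3) mat_spline_carrier[OF X] mat_spline_carrier[OF Y] in simp)
qed

section \<open>From degrees of entries to splines in the matrix variables\<close>

lemma mat_spline_entries:
  assumes "\<And>i j. i < n \<Longrightarrow> j < p \<Longrightarrow> c (i, j) \<in> V"
  shows "mat_spline 1 V n p (\<lambda>x. mat n p (\<lambda>ij. x (c ij)))"
  by (rule mat_splineI[where f = "\<lambda>i j x. x (c (i, j))"]) (use assms in \<open>auto intro: spline_fun_coord\<close>)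

text \<open>The hypothesis is applied to the generic matrix, whose entries are the variables
  themselves and so have degree 1.\<close>

lemma matrix_spline_transfer:
  assumes "\<And>V X. mat_spline 1 V n p X \<Longrightarrow>
    mat_spline k (V :: (nat \<times> nat) set) m p (\<lambda>x. F (X x))"
  shows "matrix_spline k n m p F"
  unfolding matrix_spline_def
  by (intro spline_map_mat_spline assms mat_spline_entries[where c = "\<lambda>ij. ij"]) auto

lemma matrix_pair_spline_transfer:
  assumes "\<And>V X Y. mat_spline 1 V n p X \<Longrightarrow> mat_spline 1 V r p Y \<Longrightarrow>
    mat_spline k (V :: (nat \<times> nat + nat \<times> nat) set) m p (\<lambda>x. F (X x, Y x))"
  shows "matrix_pair_spline k n r m p F"
  unfolding matrix_pair_spline_def
  \<comment> \<open>The renaming of variables is \<open>Inl\<close> for the first matrix and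
    \<open>Inr\<close> for the second.\<close>
  by (intro spline_map_mat_spline assms mat_spline_entries) auto

lemma matrix_spline_block_stack:
  assumes "block_stack p ks n m F"
  shows "matrix_spline (3 ^ length ks) n m p F"
  using mat_spline_block_stack[OF assms, of 1] by (intro matrix_spline_transfer) simp

theorem theorem3p3:
  shows
    "(\<forall>n p m \<alpha>. attention_module n p m \<alpha> \<longrightarrow> matrix_spline 3 n m p \<alpha>) \<and>
     (\<forall>n p m \<beta>. masked_attention_module n p m \<beta> \<longrightarrow> matrix_spline 3 n m p \<beta>) \<and>
     (\<forall>n r p m \<gamma>. encdec_attention_module n r p m \<gamma> \<longrightarrow> matrix_pair_spline 3 n r m p \<gamma>) \<and>
     (\<forall>n p m \<epsilon>. encoder_block n p m \<epsilon> \<longrightarrow> matrix_spline 3 n m p \<epsilon>) \<and>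
     (\<forall>n p m \<delta>. decoder_block n p m \<delta> \<longrightarrow> matrix_spline 3 n m p \<delta>) \<and>
     (\<forall>n r p m \<tau>. encdec_block n r p m \<tau> \<longrightarrow> matrix_pair_spline 5 n r m p \<tau>) \<and>
     (\<forall>t n p m F. layered_encoder t n p m F \<longrightarrow> matrix_spline (3 ^ t) n m p F) \<and>
     (\<forall>t n p m F. layered_decoder t n p m F \<longrightarrow> matrix_spline (3 ^ t) n m p F) \<and>
     (\<forall>s t n r p m T. encoder_decoder s t n r p m T \<longrightarrow>
        matrix_pair_spline (3 ^ (t + s) + 3 ^ t - 3 ^ s) n r m p T)"
proof (intro conjI allI impI)
  show "matrix_spline 3 n m p \<alpha>" if "attention_module n p m \<alpha>" for n p m \<alpha>
    using mat_spline_attention[OF _ that, of 1] by (intro matrix_spline_transfer) simp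
  show "matrix_spline 3 n m p \<beta>" if "masked_attention_module n p m \<beta>" for n p m \<beta>
    using mat_spline_masked_attention[OF _ that, of 1] by (intro matrix_spline_transfer) simp
  show "matrix_pair_spline 3 n r m p \<gamma>" if "encdec_attention_module n r p m \<gamma>" for n r p m \<gamma>
    using mat_spline_encdec_attention[OF _ _ that, of 1 _ _ 1]
    by (intro matrix_pair_spline_transfer) simp
  show "matrix_spline 3 n m p \<epsilon>" if "encoder_block n p m \<epsilon>" for n p m \<epsilon>
    using mat_spline_encoder_block[OF _ that, of 1] by (intro matrix_spline_transfer) simp
  show "matrix_spline 3 n m p \<delta>" if "decoder_block n p m \<delta>" for n p m \<delta>
    using mat_spline_decoder_block[OF _ that, of 1] by (intro matrix_spline_transfer) simp
  show "matrix_pair_spline 5 n r m p \<tau>" if "encdec_block n r p m \<tau>" for n r p m \<tau>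
    \<comment> \<open>Both inputs have degree 1, which gives 2 + 3 = 5.\<close>
    using mat_spline_encdec_block[OF _ _ that, of 1 _ _ 1]
    by (intro matrix_pair_spline_transfer) simp
  show "matrix_spline (3 ^ t) n m p F" if "layered_encoder t n p m F" for t n p m F
    using matrix_spline_block_stack[OF that[unfolded layered_encoder_def]] by simp
  show "matrix_spline (3 ^ t) n m p F" if "layered_decoder t n p m F" for t n p m F
    using that unfolding layered_decoder_def by (blast intro: matrix_spline_block_stack)
  show "matrix_pair_spline (3 ^ (t + s) + 3 ^ t - 3 ^ s) n r m p T"
    if "encoder_decoder s t n r p m T" for s t n r p m T
  proof -
    from that obtain e E where E: "block_stack p (replicate s False) n e E"
      and T: "encdec_layers n e r p E t m T"
      unfolding encoder_decoder_def layered_encoder_def by blast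
    show ?thesis
      \<comment> \<open>On inputs of degree 1 the \<open>s\<close> encoder blocks produce degree
        \<open>3 ^ s\<close>.\<close>
      using mat_spline_block_stack[OF E, of 1]
      by (intro matrix_pair_spline_transfer mat_spline_encdec_layers[OF T]) simp_all
  qed
qed

end
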